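(* Let $n\ge2$, $0<\alpha<n$ and $p=n/\alpha$. Suppose that $\Omega\in L^s(\mathbf{S}^{n-1})$ with $s\geq n/(n-\alpha)$, where $\Omega$ is homogeneous of degree zero on $\mathbb R^n$. Then there is a constant $C>0$ independent of $f$ such that $$\|M_{\Omega,\alpha}(f)\|_{L^{\infty}}\le C\|f\|_{L^{p}}$$ for all $f\in L^p(\mathbb R^n)$.
   Context: $\mathbf{S}^{n-1}$ is the unit sphere of $\mathbb R^n$ with normalized Lebesgue measure; $m$ is Lebesgue measure and $B(x,r)$ the open ball of center $x$ and radius $r$. The fractional maximal operator is $M_{\Omega,\alpha}f(x):=\sup_{r>0}\frac{1}{m(B(x,r))^{1-\alpha/n}}\int_{|x-y|<r}|\Omega(x-y)f(y)|\,dy$. *)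

theory Defs
  imports "HOL-Analysis.Analysis" "HOL-Probability.Essential_Supremum"
begin

text \<open>
  Powers of extended nonnegative reals, meant for exponents \<open>a > 0\<close>
  (so that \<open>0\<close> and \<open>\<infinity>\<close> are fixed).
\<close>

definition enn_powr :: "ennreal \<Rightarrow> real \<Rightarrow> ennreal"
  where "enn_powr x a = (if x = \<infinity> then \<infinity> else ennreal (enn2real x powr a))"

text \<open>
  The Lebesgue norm with exponent \<open>q \<in> [1, \<infinity>]\<close> of a function with values in \<open>[0, \<infinity>]\<close>;
  it is only used for measurable functions if \<open>q < \<infinity>\<close>. For \<open>q = \<infinity>\<close>
  the library's \<open>esssup\<close> is \<open>\<infinity>\<close> if the function is not measurable, so that a finite
  bound includes measurability.
\<close>

definition eL_norm :: "ennreal \<Rightarrow> 'a measure \<Rightarrow> ('a \<Rightarrow> ennreal) \<Rightarrow> ennreal"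
  where "eL_norm q M g =
    (if q = \<infinity> then esssup M g
     else enn_powr (\<integral>\<^sup>+ x. enn_powr (g x) (enn2real q) \<partial>M) (1 / enn2real q))"

definition L_norm :: "ennreal \<Rightarrow> 'a measure \<Rightarrow> ('a \<Rightarrow> 'b::real_normed_vector) \<Rightarrow> ennreal"
  where "L_norm q M f = eL_norm q M (\<lambda>x. ennreal (norm (f x)))"

text \<open>Functions are not identified when they agree almost everywhere.\<close>

definition L_space :: "ennreal \<Rightarrow> 'a measure \<Rightarrow> ('a \<Rightarrow> 'b::real_normed_vector) set"
  where "L_space q M = {f \<in> borel_measurable M. L_norm q M f < \<infinity>}"

text \<open>
  The normalized Lebesgue (surface) measure on the unit sphere, given by cones:
  the measure of \<open>A\<close> is the proportion of the unit ball taken up by the points whose direction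
  \<open>sgn x = x /\<^sub>R norm x\<close> lies in \<open>A\<close> (see \<open>emeasure_sphere_borel\<close>).  The origin, where
  \<open>sgn 0 = 0\<close> is off the sphere, is a null set.
\<close>

definition sphere_borel :: "'a::euclidean_space measure"
  where "sphere_borel =
    restrict_space (distr (uniform_measure lborel (ball 0 1)) borel sgn) (sphere 0 1)"

definition sphere_lebesgue :: "'a::euclidean_space measure"
  where "sphere_lebesgue = completion sphere_borel"

lemma space_sphere_borel: "space (sphere_borel :: 'a::euclidean_space measure) = sphere 0 1"
  by (simp add: sphere_borel_def space_restrict_space)

lemma sets_sphere_borel:
  "sets (sphere_borel :: 'a::euclidean_space measure) = sets (restrict_space borel (sphere 0 1))"
  unfolding sphere_borel_def by (intro sets_restrict_space_cong) simp

lemma emeasure_sphere_borel: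
  fixes A :: "'a::euclidean_space set"
  assumes A: "A \<in> sets borel" "A \<subseteq> sphere 0 1"
  shows "emeasure sphere_borel A =
    emeasure lborel {x \<in> ball 0 1. sgn x \<in> A} / emeasure lborel (ball (0::'a) 1)"
proof -
  have sgn: "sgn \<in> borel_measurable (borel :: 'a measure)"
    unfolding sgn_div_norm by measurable
  have "emeasure sphere_borel A = emeasure (distr (uniform_measure lborel (ball 0 1)) borel sgn) A"
    unfolding sphere_borel_def by (rule emeasure_restrict_space) (use A in auto)
  also have "\<dots> = emeasure (uniform_measure lborel (ball 0 1)) (sgn -` A)"
    using sgn A by (subst emeasure_distr) auto
  also have "\<dots> = emeasure lborel (ball 0 1 \<inter> sgn -` A) / emeasure lborel (ball (0::'a) 1)"
    using measurable_sets[OF sgn A(1)] by (intro emeasure_uniform_measure) auto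
  also have "ball 0 1 \<inter> sgn -` A = {x \<in> ball 0 1. sgn x \<in> A}"
    by auto
  finally show ?thesis .
qed

lemma emeasure_sphere_borel_UNIV: "emeasure sphere_borel (sphere (0::'a::euclidean_space) 1) = 1"
proof -
  have b: "emeasure lborel (ball (0::'a) 1) \<noteq> \<infinity>" "emeasure lborel (ball (0::'a) 1) \<noteq> 0"
    by (simp_all add: emeasure_ball unit_ball_vol_def Gamma_real_pos less_imp_neq
        pos_add_strict ennreal_eq_0_iff not_le)
  have "{x \<in> ball 0 1. sgn x \<in> sphere (0::'a) 1} = ball 0 1 - {0}"
    by (auto simp: norm_sgn)
  moreover have "emeasure lborel (ball 0 1 - {0::'a}) = emeasure lborel (ball (0::'a) 1)"
    by (subst emeasure_Diff) auto
  ultimately show ?thesis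
    using b by (subst emeasure_sphere_borel) (auto intro!: ennreal_divide_self simp: top.not_eq_extremum)
qed

definition homogeneous_degree_zero :: "('a::real_vector \<Rightarrow> 'b) \<Rightarrow> bool"
  where "homogeneous_degree_zero \<Omega> \<longleftrightarrow> (\<forall>t>0. \<forall>x. \<Omega> (t *\<^sub>R x) = \<Omega> x)"

definition fractional_maximal ::
  "('a::euclidean_space \<Rightarrow> complex) \<Rightarrow> real \<Rightarrow> ('a \<Rightarrow> complex) \<Rightarrow> 'a \<Rightarrow> ennreal"
  where "fractional_maximal \<Omega> \<alpha> f x =
    (SUP r\<in>{0<..}.
      ennreal (1 / measure lebesgue (ball x r) powr (1 - \<alpha> / real DIM('a))) *
      (\<integral>\<^sup>+ y \<in> {y. norm (x - y) < r}. ennreal (norm (\<Omega> (x - y) * f y)) \<partial>lebesgue))"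

end

theory Submission
  imports Defs
begin

text \<open>
  Let \<open>q = n / (n - \<alpha>)\<close> be the exponent dual to \<open>p = n / \<alpha>\<close>. By Hoelder, the integral over
  \<open>|x - y| < r\<close> is at most the \<open>L\<^sup>q\<close> norm of \<open>\<Omega>\<close> on \<open>B(0, r)\<close> times the \<open>L\<^sup>p\<close> norm of \<open>f\<close>.
  Homogeneity gives \<open>\<integral>|\<Omega>|\<^sup>q = m(B(0, r)) \<integral>|\<Omega>|\<^sup>q\<close>, over \<open>B(0, r)\<close> on the left and over the sphere
  on the right, and \<open>m(B(0, r))\<close> to the power \<open>1/q = 1 - \<alpha>/n\<close> cancels the normalization; the
  integral over the sphere is finite because the sphere has finite measure and \<open>s \<ge> q\<close>.
  Measurability of the maximal function also has to be shown, since \<open>esssup\<close> is infinite otherwise: \<open>\<Omega>\<close> and \<open>f\<close> are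
  replaced by Borel functions, and the supremum is restricted to rational radii.
\<close>

section \<open>Hoelder's inequality\<close>

text \<open>Young's inequality for \<open>u\<close> and \<open>v\<close>, each divided by its norm,
  is integrated termwise. Dividing by the norms requires \<open>A\<close> and \<open>B\<close> to be
  positive, so a vanishing integral is a separate case.\<close>

lemma nn_integral_Holder:
  fixes u v :: "'a \<Rightarrow> real"
  assumes [measurable]: "u \<in> borel_measurable M" "v \<in> borel_measurable M"
    and nonneg: "\<And>x. 0 \<le> u x" "\<And>x. 0 \<le> v x"
    and a: "a > 1" and b: "b > 1" and ab: "1 / a + 1 / b = 1"
    and A: "(\<integral>\<^sup>+ x. ennreal (u x powr a) \<partial>M) = ennreal A" "0 \<le> A"
    and B: "(\<integral>\<^sup>+ x. ennreal (v x powr b) \<partial>M) = ennreal B" "0 \<le> B"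
  shows "(\<integral>\<^sup>+ x. ennreal (u x * v x) \<partial>M) \<le> ennreal (A powr (1 / a) * B powr (1 / b))"
proof (cases "A = 0 \<or> B = 0")
  case True
  \<comment> \<open>A zero integral forces one factor to vanish almost everywhere, so the left-hand
    side is 0.\<close>
  have "AE x in M. u x * v x = 0"
    using True
  proof
    assume "A = 0"
    with A have "AE x in M. ennreal (u x powr a) = 0"
      by (intro nn_integral_0_iff_AE[THEN iffD1]) auto
    then show ?thesis by eventually_elim (auto simp: ennreal_eq_0_iff)
  next
    assume "B = 0"
    with B have "AE x in M. ennreal (v x powr b) = 0"
      by (intro nn_integral_0_iff_AE[THEN iffD1]) auto
    then show ?thesis by eventually_elim (auto simp: ennreal_eq_0_iff)
  qed
  then have "(\<integral>\<^sup>+ x. ennreal (u x * v x) \<partial>M) = (\<integral>\<^sup>+ x. 0 \<partial>M)"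
    by (intro nn_integral_cong_AE) auto
  then show ?thesis by simp
next
  case False
  with A B have pos: "A > 0" "B > 0" by auto
  \<comment> \<open>This is the claimed bound. Multiplying the normalized Young inequality by
    \<open>c\<close> gives two terms with integrals \<open>c / a\<close> and \<open>c / b\<close>,
    which add up to \<open>c\<close>.\<close>
  define c where "c = A powr (1 / a) * B powr (1 / b)"
  have c: "c > 0" using pos by (simp add: c_def)
  have young: "u x * v x \<le> c / (a * A) * u x powr a + c / (b * B) * v x powr b" for x
  proof -
    have "(u x / A powr (1 / a)) * (v x / B powr (1 / b))
        \<le> (u x / A powr (1 / a)) powr a / a + (v x / B powr (1 / b)) powr b / b"
      using a b ab nonneg by (intro Youngs_inequality) auto
    also have "(u x / A powr (1 / a)) powr a = u x powr a / A"
      using a pos nonneg by (simp add: powr_divide powr_powr)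
    also have "(v x / B powr (1 / b)) powr b = v x powr b / B"
      using b pos nonneg by (simp add: powr_divide powr_powr)
    finally have "u x * v x / c \<le> u x powr a / A / a + v x powr b / B / b"
      by (simp add: c_def)
    then have "u x * v x \<le> c * (u x powr a / A / a + v x powr b / B / b)"
      using c by (simp add: field_simps)
    then show ?thesis by (simp add: algebra_simps)
  qed
  have "(\<integral>\<^sup>+ x. ennreal (u x * v x) \<partial>M)
      \<le> (\<integral>\<^sup>+ x. ennreal (c / (a * A)) * ennreal (u x powr a)
            + ennreal (c / (b * B)) * ennreal (v x powr b) \<partial>M)"
    using young c a b pos
    by (intro nn_integral_mono) (simp flip: ennreal_mult' ennreal_plus)
  also have "\<dots> = ennreal (c / (a * A)) * ennreal A + ennreal (c / (b * B)) * ennreal B"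
    by (simp add: nn_integral_add nn_integral_cmult A B)
  also have "\<dots> = ennreal (c / a + c / b)"
    using c a b pos by (simp flip: ennreal_mult' ennreal_plus)
  also have "c / a + c / b = c"
    using ab by (metis distrib_left mult.right_neutral times_divide_eq_right)
  finally show ?thesis by (simp add: c_def)
qed

section \<open>Reflected translations of Lebesgue measure\<close>

text \<open>The map is affine with linear part -1, whose Jacobian has absolute value 1.\<close>

lemma lborel_distr_diff:
  fixes x :: "'a::euclidean_space"
  shows "distr lborel borel (\<lambda>y. x - y) = lborel"
  by (subst (2) lborel_affine[of "-1" x]) (auto simp: density_1)

lemma AE_lborel_diff:
  fixes x :: "'a::euclidean_space"
  assumes "AE z in lborel. P z"
  shows "AE y in lborel. P (x - y)"
proof -
  have "AE z in distr lborel borel (\<lambda>y. x - y). P z"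
    unfolding lborel_distr_diff by (rule assms)
  then show ?thesis
    by (rule AE_distrD[rotated]) simp
qed

lemma nn_integral_lborel_diff:
  fixes x :: "'a::euclidean_space"
  assumes [measurable]: "g \<in> borel_measurable borel"
  shows "(\<integral>\<^sup>+ y. g (x - y) \<partial>lborel) = (\<integral>\<^sup>+ z. g z \<partial>lborel)"
  by (subst (2) lborel_distr_diff[of x, symmetric]) (simp add: nn_integral_distr)

section \<open>Polar coordinates for functions of the direction\<close>

lemma nn_integral_sphere_borel:
  fixes H :: "'a::euclidean_space \<Rightarrow> ennreal"
  assumes [measurable]: "H \<in> borel_measurable borel"
  shows "(\<integral>\<^sup>+ x. H x \<partial>sphere_borel) =
    (\<integral>\<^sup>+ x. H (sgn x) * indicator (ball 0 1) x \<partial>lborel) / emeasure lborel (ball (0::'a) 1)"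
proof -
  have [measurable]: "sgn \<in> borel_measurable (borel :: 'a measure)"
    unfolding sgn_div_norm by measurable
  have [measurable]: "sphere (0::'a) 1 \<in> sets borel"
    by simp
  have "(\<integral>\<^sup>+ x. H x \<partial>sphere_borel) =
      (\<integral>\<^sup>+ x. H (sgn x) * indicator (sphere 0 1) (sgn x) \<partial>uniform_measure lborel (ball (0::'a) 1))"
    unfolding sphere_borel_def
    by (subst nn_integral_restrict_space, simp, subst nn_integral_distr) auto
  also have "\<dots> = (\<integral>\<^sup>+ x. H (sgn x) * indicator (sphere 0 1) (sgn x) * indicator (ball 0 1) x \<partial>lborel)
      / emeasure lborel (ball (0::'a) 1)"
    by (subst nn_integral_uniform_measure) auto
  \<comment> \<open>Only at the origin does \<open>sgn\<close> leave the sphere, and a point is a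
    null set.\<close>
  also have "(\<integral>\<^sup>+ x. H (sgn x) * indicator (sphere 0 1) (sgn x) * indicator (ball 0 1) x \<partial>lborel)
      = (\<integral>\<^sup>+ x. H (sgn x) * indicator (ball (0::'a) 1) x \<partial>lborel)"
    using AE_lborel_singleton[of "0::'a"]
    by (intro nn_integral_cong_AE, eventually_elim) (simp add: norm_sgn)
  finally show ?thesis .
qed

text \<open>Directions are unchanged by the dilation by \<open>r\<close>, which maps the unit ball
  onto the ball of radius \<open>r\<close> and multiplies volumes by \<open>r ^ DIM('a)\<close>. The
  same factor relates the volumes of the two balls.\<close>

lemma nn_integral_ball_sgn:
  fixes H :: "'a::euclidean_space \<Rightarrow> ennreal"
  assumes [measurable]: "H \<in> borel_measurable borel" and r: "r > 0"
  shows "(\<integral>\<^sup>+ x. H (sgn x) * indicator (ball 0 r) x \<partial>lborel) =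
    emeasure lborel (ball (0::'a) r) * (\<integral>\<^sup>+ x. H x \<partial>sphere_borel)"
proof -
  have [measurable]: "sgn \<in> borel_measurable (borel :: 'a measure)"
    unfolding sgn_div_norm by measurable
  have [measurable]: "ball (0::'a) 1 \<in> sets borel"
    by simp
  have [measurable]: "ball (0::'a) r \<in> sets borel"
    by simp
  define V where "V = emeasure lborel (ball (0::'a) 1)"
  have V: "V \<noteq> 0" "V \<noteq> \<infinity>"
    by (simp_all add: V_def emeasure_ball unit_ball_vol_def Gamma_real_pos less_imp_neq
        pos_add_strict ennreal_eq_0_iff not_le)
  have Vr: "emeasure lborel (ball (0::'a) r) = ennreal (r ^ DIM('a)) * V"
    using r by (simp add: V_def emeasure_ball ennreal_mult' mult.commute)
  let ?J = "\<integral>\<^sup>+ x. H (sgn x) * indicator (ball (0::'a) 1) x \<partial>lborel"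
  have "(\<integral>\<^sup>+ x. H (sgn x) * indicator (ball 0 r) x \<partial>(lborel :: 'a measure)) =
      (\<integral>\<^sup>+ x. H (sgn x) * indicator (ball 0 r) x
        \<partial>density (distr lborel borel (\<lambda>x::'a. 0 + r *\<^sub>R x)) (\<lambda>_. ennreal (\<bar>r\<bar> ^ DIM('a))))"
    using r by (subst lborel_affine[of r 0]) auto
  also have "\<dots> = ennreal (r ^ DIM('a)) *
      (\<integral>\<^sup>+ x. H (sgn (r *\<^sub>R x)) * indicator (ball 0 r) (r *\<^sub>R x) \<partial>(lborel :: 'a measure))"
    using r by (simp add: nn_integral_density nn_integral_distr nn_integral_cmult)
  also have "(\<integral>\<^sup>+ x. H (sgn (r *\<^sub>R x)) * indicator (ball 0 r) (r *\<^sub>R x) \<partial>(lborel :: 'a measure)) = ?J"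
    using r by (intro nn_integral_cong) (auto simp: sgn_scaleR indicator_def)
  \<comment> \<open>Dividing and multiplying by \<open>V\<close> cancels in \<open>ennreal\<close>
    because \<open>V\<close> is neither 0 nor infinite. The quotient is the integral over the
    sphere.\<close>
  also have "?J = V * (?J / V)"
  proof -
    have "V * (?J / V) = ?J * V / V"
      by (simp only: ennreal_times_divide mult.commute)
    also have "\<dots> = ?J"
      using V by (intro ennreal_mult_divide_eq) auto
    finally show ?thesis by (rule sym)
  qed
  also have "?J / V = (\<integral>\<^sup>+ x. H x \<partial>sphere_borel)"
    unfolding V_def by (rule nn_integral_sphere_borel[symmetric]) measurable
  finally show ?thesis
    unfolding Vr by (simp only: mult.assoc)
qed

text \<open>The cone over a null set of the sphere is Lebesgue null: it is null in every ball by the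
  polar formula for its indicator, and countably many balls cover the space.\<close>

lemma AE_lborel_sgn:
  assumes "AE x in sphere_borel. P (x::'a::euclidean_space)"
  shows "AE x in lborel. P (sgn (x::'a))"
proof -
  have [measurable]: "sgn \<in> borel_measurable (borel :: 'a measure)"
    unfolding sgn_div_norm by measurable
  obtain N where N: "{x \<in> space sphere_borel. \<not> P x} \<subseteq> N" "emeasure sphere_borel N = 0"
      "N \<in> sets (sphere_borel :: 'a measure)"
    using assms by (elim AE_E)
  have [measurable]: "N \<in> sets borel"
    using N(3) by (simp add: sets_sphere_borel sets_restrict_space_iff)
  \<comment> \<open>The successor keeps the radius positive, as the polar formula demands.\<close>
  have "AE x in lborel. indicator N (sgn x) * indicator (ball 0 (real (Suc k))) x = (0::ennreal)"
    for k
  proof -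
    have [measurable]: "ball (0::'a) (real (Suc k)) \<in> sets borel"
      by (rule borel_open) simp
    have "(\<integral>\<^sup>+ x. indicator N (sgn x) * indicator (ball 0 (real (Suc k))) x \<partial>lborel) =
        emeasure lborel (ball (0::'a) (real (Suc k))) * (\<integral>\<^sup>+ x. indicator N x \<partial>sphere_borel)"
      by (rule nn_integral_ball_sgn) auto
    also have "\<dots> = 0" using N by simp
    finally show ?thesis by (intro nn_integral_0_iff_AE[THEN iffD1]) measurable
  qed
  then have "AE x in lborel. \<forall>k. indicator N (sgn x) * indicator (ball 0 (real (Suc k))) x = (0::ennreal)"
    by (intro AE_all_countable[THEN iffD2] allI)
  moreover have "AE x in lborel. x \<noteq> (0::'a)" by (rule AE_lborel_singleton)
  ultimately show ?thesis
  proof eventually_elim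
    fix x :: 'a assume x: "\<forall>k. indicator N (sgn x) * indicator (ball 0 (real (Suc k))) x = (0::ennreal)"
      "x \<noteq> 0"
    obtain k where "norm x < real k" using reals_Archimedean2 by blast
    then have "x \<in> ball 0 (real (Suc k))" by simp
    with x(1) have "sgn x \<notin> N" by (auto simp: indicator_def split: if_splits)
    moreover have "sgn x \<in> space sphere_borel" using x(2) by (simp add: space_sphere_borel norm_sgn)
    ultimately show "P (sgn x)" using N(1) by auto
  qed
qed

section \<open>Lebesgue norms and Borel representatives on the sphere\<close>

lemma L_norm_ennreal:
  assumes "a > 0"
  shows "L_norm (ennreal a) M f = enn_powr (\<integral>\<^sup>+ x. ennreal (norm (f x) powr a) \<partial>M) (1 / a)"
  using assms by (simp add: L_norm_def eL_norm_def enn_powr_def)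

lemma L_norm_finite_iff:
  assumes "a > 0"
  shows "L_norm (ennreal a) M f < \<infinity> \<longleftrightarrow> (\<integral>\<^sup>+ x. ennreal (norm (f x) powr a) \<partial>M) < \<infinity>"
  unfolding L_norm_ennreal[OF assms] by (auto simp: enn_powr_def less_top)

text \<open>On a finite measure space higher integrability implies lower. For finite exponents it
  suffices that \<open>y powr q\<close> is at most 1 for \<open>y \<le> 1\<close> and at most
  \<open>y powr t\<close> otherwise; for the exponent \<infinity> the integrand is essentially
  bounded.\<close>

lemma L_space_finite_measure_nn_integral_powr:
  assumes "finite_measure M" and f: "f \<in> L_space s M" and q: "q > 0" "ennreal q \<le> s"
  shows "(\<integral>\<^sup>+ x. ennreal (norm (f x) powr q) \<partial>M) < \<infinity>"
proof -
  interpret finite_measure M by fact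
  have [measurable]: "f \<in> borel_measurable M" and fin: "L_norm s M f < \<infinity>"
    using f by (auto simp: L_space_def)
  show ?thesis
  proof (cases s)
    case (real t)
    with q have t: "q \<le> t" "t > 0" by (auto simp: ennreal_le_iff2)
    have "norm (f x) powr q \<le> 1 + norm (f x) powr t" for x
    proof (cases "norm (f x) \<le> 1")
      case True
      then have "norm (f x) powr q \<le> 1" using q by (simp add: powr_le1)
      then show ?thesis by (simp add: add_increasing2)
    next
      case False
      then have "norm (f x) powr q \<le> norm (f x) powr t" using t by (intro powr_mono) auto
      then show ?thesis by simp
    qed
    then have "(\<integral>\<^sup>+ x. ennreal (norm (f x) powr q) \<partial>M)
        \<le> (\<integral>\<^sup>+ x. 1 + ennreal (norm (f x) powr t) \<partial>M)"
      by (intro nn_integral_mono) (simp flip: ennreal_1 ennreal_plus)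
    also have "\<dots> = emeasure M (space M) + (\<integral>\<^sup>+ x. ennreal (norm (f x) powr t) \<partial>M)"
      by (simp add: nn_integral_add)
    also have "\<dots> < \<infinity>"
      using fin t L_norm_finite_iff[of t M f] by (simp add: real less_top[symmetric])
    finally show ?thesis .
  next
    case top
    define c where "c = enn2real (esssup M (\<lambda>x. ennreal (norm (f x))))"
    have c: "esssup M (\<lambda>x. ennreal (norm (f x))) = ennreal c"
      using fin top by (simp add: c_def L_norm_def eL_norm_def less_top)
    have "AE x in M. ennreal (norm (f x)) \<le> ennreal c"
      unfolding c[symmetric] by (rule esssup_AE)
    then have "(\<integral>\<^sup>+ x. ennreal (norm (f x) powr q) \<partial>M) \<le> (\<integral>\<^sup>+ x. ennreal (c powr q) \<partial>M)"
      using q by (intro nn_integral_mono_AE)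
        (auto simp: c_def intro!: ennreal_leI powr_mono2)
    also have "\<dots> < \<infinity>"
      by (simp add: ennreal_mult_eq_top_iff less_top[symmetric])
    finally show ?thesis .
  qed
qed

text \<open>Measurability of \<Omega> is known only for the completed measure on the sphere, whereas
  composing with \<open>sgn\<close> and changing variables call for a Borel function on the whole
  space.\<close>

lemma ex_borel_norm_sphere:
  fixes \<Omega> :: "'a::euclidean_space \<Rightarrow> 'b::real_normed_vector"
  assumes "\<Omega> \<in> borel_measurable sphere_lebesgue"
  obtains w :: "'a \<Rightarrow> real" where "w \<in> borel_measurable borel" "\<And>x. 0 \<le> w x"
    "AE x in sphere_borel. norm (\<Omega> x) = w x"
proof -
  have "(\<lambda>x. norm (\<Omega> x)) \<in> borel_measurable (completion sphere_borel)"
    using assms unfolding sphere_lebesgue_def by measurable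
  from completion_ex_borel_measurable_real[OF this] obtain g
    where g: "g \<in> borel_measurable sphere_borel" "AE x in sphere_borel. norm (\<Omega> x) = g x"
    by auto
  have "g \<in> borel_measurable (restrict_space borel (sphere 0 1))"
    using g(1) by (simp add: sets_sphere_borel cong: measurable_cong_sets)
  then have gm: "(\<lambda>x. indicator (sphere 0 1) x *\<^sub>R g x) \<in> borel_measurable borel"
    by (subst (asm) borel_measurable_restrict_space_iff) auto
  show thesis
  proof
    \<comment> \<open>The representative is extended by 0 off the sphere. The absolute value makes
      it nonnegative everywhere and changes nothing where it equals a norm.\<close>
    show "(\<lambda>x. \<bar>indicator (sphere 0 1) x *\<^sub>R g x\<bar>) \<in> borel_measurable borel"
      using gm by measurable
    show "AE x in sphere_borel. norm (\<Omega> x) = \<bar>indicator (sphere 0 1) x *\<^sub>R g x\<bar>"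
      using g(2) AE_space
    proof eventually_elim
      case (elim x)
      moreover from elim have "0 \<le> g x" by (metis norm_ge_zero)
      ultimately show ?case by (simp add: space_sphere_borel)
    qed
  qed simp
qed

section \<open>Measurability of the maximal function\<close>

text \<open>Since the balls are open, the integral is continuous from the left in \<open>r\<close>,
  so smaller radii approximate it. The factor \<open>c\<close> only grows when the radius shrinks,
  so a rational radius just below \<open>r\<close> does almost as well.\<close>

lemma SUP_radius_eq_SUP_rat:
  fixes c :: "real \<Rightarrow> ennreal" and k :: "'a::euclidean_space \<Rightarrow> ennreal"
  assumes [measurable]: "k \<in> borel_measurable borel"
    and antimono: "\<And>r r'. 0 < r \<Longrightarrow> r \<le> r' \<Longrightarrow> c r' \<le> c r"
  shows "(SUP r\<in>{0<..}. c r * (\<integral>\<^sup>+ y \<in> {y. norm (x - y) < r}. k y \<partial>lborel)) =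
    (SUP r\<in>{0<..} \<inter> \<rat>. c r * (\<integral>\<^sup>+ y \<in> {y. norm (x - y) < r}. k y \<partial>lborel))"
    (is "(SUP r\<in>_. c r * ?I r) = ?R")
proof (rule antisym)
  show "(SUP r\<in>{0<..}. c r * ?I r) \<le> ?R"
  proof (rule SUP_least)
    fix r :: real assume "r \<in> {0<..}"
    then have r: "r > 0" by simp
    \<comment> \<open>Radii increasing to \<open>r\<close> and strictly below it; the shift by 2
      makes the first one \<open>r / 2\<close> and hence positive.\<close>
    define \<rho> where "\<rho> j = r - r / real (j + 2)" for j :: nat
    have \<rho>: "0 < \<rho> j" "\<rho> j < r" for j
      using r by (auto simp: \<rho>_def field_simps intro: add_pos_nonneg)
    have \<rho>_mono: "\<rho> i \<le> \<rho> j" if "i \<le> j" for i j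
      using r that by (auto simp: \<rho>_def intro!: divide_left_mono)
    have \<rho>_lim: "\<rho> \<longlonglongrightarrow> r"
    proof -
      have "(\<lambda>j. r - r / real (j + 2)) \<longlonglongrightarrow> r - 0"
        by (intro tendsto_diff tendsto_const LIMSEQ_ignore_initial_segment[OF lim_const_over_n])
      then show ?thesis by (simp add: \<rho>_def[abs_def])
    qed
    have m[measurable]: "{y. norm (x - y) < d} \<in> sets borel" for d
      by (intro borel_open open_Collect_less continuous_intros)
    have "?I r = (\<integral>\<^sup>+ y. (SUP j. k y * indicator {y. norm (x - y) < \<rho> j} y) \<partial>lborel)"
    proof (intro nn_integral_cong)
      fix y
      have "indicator {y. norm (x - y) < r} y = (SUP j. indicator {y. norm (x - y) < \<rho> j} y :: ennreal)"
      proof (cases "norm (x - y) < r")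
        case True
        then have "eventually (\<lambda>j. norm (x - y) < \<rho> j) sequentially"
          using \<rho>_lim by (simp add: order_tendstoD)
        then obtain j where "norm (x - y) < \<rho> j"
          by (auto simp: eventually_sequentially)
        then have "(SUP j. indicator {y. norm (x - y) < \<rho> j} y :: ennreal) = 1"
          by (intro antisym SUP_least SUP_upper2[of j]) (auto simp: indicator_def)
        with True show ?thesis by simp
      next
        case False
        then have "\<not> norm (x - y) < \<rho> j" for j
          using \<rho>(2)[of j] by linarith
        with False show ?thesis by simp
      qed
      then show "k y * indicator {y. norm (x - y) < r} y =
          (SUP j. k y * indicator {y. norm (x - y) < \<rho> j} y)"
        by (simp add: SUP_mult_left_ennreal)
    qed
    also have "\<dots> = (SUP j. ?I (\<rho> j))"
      by (intro nn_integral_monotone_convergence_SUP)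
        (auto simp: incseq_def le_fun_def indicator_def dest: \<rho>_mono intro!: mult_left_mono
          elim: less_le_trans)
    finally have "c r * ?I r = (SUP j. c r * ?I (\<rho> j))"
      by (simp add: SUP_mult_left_ennreal)
    also have "\<dots> \<le> ?R"
    proof (rule SUP_least)
      fix j
      obtain d where d: "d \<in> \<rat>" "\<rho> j < d" "d < r"
        using Rats_dense_in_real[OF \<rho>(2)] by blast
      \<comment> \<open>Both factors increase: \<open>c\<close> because \<open>d < r\<close>, the
        integral because \<open>\<rho> j < d\<close>.\<close>
      have "c r * ?I (\<rho> j) \<le> c d * ?I d"
        using d \<rho>(1)[of j]
        by (intro mult_mono antimono nn_integral_mono) (auto simp: indicator_def)
      then show "c r * ?I (\<rho> j) \<le> ?R"
        using d \<rho>(1)[of j] by (intro SUP_upper2[of d]) auto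
    qed
    finally show "c r * ?I r \<le> ?R" .
  qed
qed (rule SUP_subset_mono, auto)

text \<open>With rational radii the supremum is countable, and for each radius the integral is
  measurable in \<open>x\<close> by Tonelli's theorem.\<close>

lemma borel_measurable_SUP_radius:
  fixes c :: "real \<Rightarrow> ennreal" and k :: "'a::euclidean_space \<Rightarrow> 'a \<Rightarrow> ennreal"
  assumes [measurable]: "case_prod k \<in> borel_measurable (borel \<Otimes>\<^sub>M borel)"
    and antimono: "\<And>r r'. 0 < r \<Longrightarrow> r \<le> r' \<Longrightarrow> c r' \<le> c r"
  shows "(\<lambda>x. SUP r\<in>{0<..}. c r * (\<integral>\<^sup>+ y \<in> {y. norm (x - y) < r}. k x y \<partial>lborel))
    \<in> borel_measurable borel"
proof -
  have "k x \<in> borel_measurable borel" for x by measurable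
  then have "(\<lambda>x. SUP r\<in>{0<..}. c r * (\<integral>\<^sup>+ y \<in> {y. norm (x - y) < r}. k x y \<partial>lborel)) =
      (\<lambda>x. SUP r\<in>{0<..} \<inter> \<rat>. c r * (\<integral>\<^sup>+ y \<in> {y. norm (x - y) < r}. k x y \<partial>lborel))"
    using antimono by (intro ext SUP_radius_eq_SUP_rat) auto
  also have "\<dots> \<in> borel_measurable borel"
  proof (intro borel_measurable_SUP)
    show "countable ({0<..} \<inter> \<rat> :: real set)"
      by (intro countable_Int2 countable_rat)
    fix r :: real
    have "(\<lambda>(x, y). k x y * indicator {y. norm (x - y) < r} y) \<in>
        borel_measurable (borel \<Otimes>\<^sub>M (lborel :: 'a measure))"
      unfolding indicator_def by measurable
    then show "(\<lambda>x. c r * (\<integral>\<^sup>+ y \<in> {y. norm (x - y) < r}. k x y \<partial>lborel)) \<in> borel_measurable borel"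
      by (intro borel_measurable_times_ennreal lborel.borel_measurable_nn_integral) auto
  qed
  finally show ?thesis .
qed

section \<open>The bound for the maximal function\<close>

text \<open>Since \<open>y \<mapsto> x - y\<close> pulls null sets back to null sets, the integrands
  agree for almost every \<open>y\<close> whatever \<open>x\<close> is; hence the equality at every
  point. The volume of a ball does not depend on its center.\<close>

lemma fractional_maximal_cong_AE:
  fixes \<Omega> f :: "'a::euclidean_space \<Rightarrow> complex"
  assumes \<Omega>: "AE z in lborel. norm (\<Omega> z) = g z" and f: "AE y in lborel. norm (f y) = h y"
  shows "fractional_maximal \<Omega> \<alpha> f x =
    (SUP r\<in>{0<..}. ennreal (1 / measure lborel (ball (0::'a) r) powr (1 - \<alpha> / real DIM('a))) *
      (\<integral>\<^sup>+ y \<in> {y. norm (x - y) < r}. ennreal (g (x - y) * h y) \<partial>lborel))"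
  unfolding fractional_maximal_def
proof (intro SUP_cong refl arg_cong2[where f="(*)"])
  fix r :: real assume "r \<in> {0<..}"
  then show "ennreal (1 / measure lebesgue (ball x r) powr (1 - \<alpha> / real DIM('a))) =
      ennreal (1 / measure lborel (ball (0::'a) r) powr (1 - \<alpha> / real DIM('a)))"
    by (simp add: content_ball)
  show "(\<integral>\<^sup>+ y \<in> {y. norm (x - y) < r}. ennreal (norm (\<Omega> (x - y) * f y)) \<partial>lebesgue) =
      (\<integral>\<^sup>+ y \<in> {y. norm (x - y) < r}. ennreal (g (x - y) * h y) \<partial>lborel)"
    unfolding nn_integral_completion
    using AE_lborel_diff[OF \<Omega>, of x] f
    by (intro nn_integral_cong_AE, eventually_elim) (simp add: norm_mult)
qed

text \<open>Hoelder's inequality for the kernel cut off to the ball. After the substitution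
  \<open>z = x - y\<close>, the polar formula evaluates the integral of the power of the
  kernel.\<close>

lemma nn_integral_ball_rough_kernel_le:
  fixes w h :: "'a::euclidean_space \<Rightarrow> real"
  assumes [measurable]: "w \<in> borel_measurable borel" "h \<in> borel_measurable borel"
    and nonneg: "\<And>x. 0 \<le> w x" "\<And>x. 0 \<le> h x"
    and a: "a > 1" and b: "b > 1" and ab: "1 / a + 1 / b = 1"
    and K: "(\<integral>\<^sup>+ x. ennreal (w x powr a) \<partial>sphere_borel) = ennreal K" "0 \<le> K"
    and H: "(\<integral>\<^sup>+ x. ennreal (h x powr b) \<partial>lborel) = ennreal H" "0 \<le> H"
    and r: "r > 0"
  shows "(\<integral>\<^sup>+ y \<in> {y. norm (x - y) < r}. ennreal (w (sgn (x - y)) * h y) \<partial>lborel)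
    \<le> ennreal ((measure lborel (ball (0::'a) r) * K) powr (1 / a) * H powr (1 / b))"
proof -
  have [measurable]: "sgn \<in> borel_measurable (borel :: 'a measure)"
    unfolding sgn_div_norm by measurable
  have [measurable]: "ball (0::'a) r \<in> sets borel" by simp
  \<comment> \<open>The cutoff moves the domain of integration into the first factor, so that
    Hoelder's inequality applies on the whole space.\<close>
  define u where "u z = w (sgn z) * indicator (ball 0 r) z" for z :: 'a
  have [measurable]: "u \<in> borel_measurable borel"
    unfolding u_def by measurable
  have "(\<integral>\<^sup>+ y. ennreal (u (x - y) powr a) \<partial>lborel) = (\<integral>\<^sup>+ z. ennreal (u z powr a) \<partial>lborel)"
    by (rule nn_integral_lborel_diff) measurable
  also have "\<dots> = (\<integral>\<^sup>+ z. ennreal (w (sgn z) powr a) * indicator (ball 0 r) z \<partial>lborel)"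
    by (intro nn_integral_cong) (simp add: u_def indicator_def)
  also have "\<dots> = emeasure lborel (ball (0::'a) r) * ennreal K"
    using r by (subst nn_integral_ball_sgn[where H="\<lambda>z. ennreal (w z powr a)"]) (simp_all add: K)
  also have "\<dots> = ennreal (measure lborel (ball (0::'a) r) * K)"
    using K r by (simp add: ennreal_mult' emeasure_ball content_ball)
  finally have U: "(\<integral>\<^sup>+ y. ennreal (u (x - y) powr a) \<partial>lborel) = ennreal (measure lborel (ball (0::'a) r) * K)" .
  have "(\<integral>\<^sup>+ y \<in> {y. norm (x - y) < r}. ennreal (w (sgn (x - y)) * h y) \<partial>lborel) =
      (\<integral>\<^sup>+ y. ennreal (u (x - y) * h y) \<partial>lborel)"
    by (intro nn_integral_cong) (simp add: u_def indicator_def)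
  also have "\<dots> \<le> ennreal ((measure lborel (ball (0::'a) r) * K) powr (1 / a) * H powr (1 / b))"
  proof (rule nn_integral_Holder[OF _ _ _ _ a b ab U _ H])
    show "(\<lambda>y. u (x - y)) \<in> borel_measurable lborel" by measurable
    show "h \<in> borel_measurable lborel" by measurable
    show "0 \<le> u (x - y)" "0 \<le> h y" for y
      using nonneg by (simp_all add: u_def)
    show "0 \<le> measure lborel (ball (0::'a) r) * K"
      using K(2) by (intro mult_nonneg_nonneg) auto
  qed
  finally show ?thesis .
qed

lemma fractional_maximal_bounded:
  fixes \<Omega> :: "'a::euclidean_space \<Rightarrow> complex"
  defines "n \<equiv> real DIM('a)"
  assumes \<alpha>: "0 < \<alpha>" "\<alpha> < n"
    and hom: "homogeneous_degree_zero \<Omega>"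
    and s: "s \<ge> ennreal (n / (n - \<alpha>))"
    and \<Omega>: "\<Omega> \<in> L_space s sphere_lebesgue"
  shows "\<exists>C>0. \<forall>f \<in> L_space (ennreal (n / \<alpha>)) lebesgue.
    eL_norm \<infinity> lebesgue (fractional_maximal \<Omega> \<alpha> f)
      \<le> ennreal C * L_norm (ennreal (n / \<alpha>)) lebesgue f"
proof -
  \<comment> \<open>These exponents are conjugate, and \<open>1 / q\<close> is exactly the power of
    the volume in the definition of the maximal function.\<close>
  define q p where "q = n / (n - \<alpha>)" and "p = n / \<alpha>"
  have qp: "q > 1" "p > 1" "1 / q + 1 / p = 1" "1 / q = 1 - \<alpha> / n"
    using \<alpha> by (simp_all add: q_def p_def field_simps)
  have [measurable]: "sgn \<in> borel_measurable (borel :: 'a measure)"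
    unfolding sgn_div_norm by measurable
  have \<Omega>m: "\<Omega> \<in> borel_measurable sphere_lebesgue"
    using \<Omega> by (simp add: L_space_def)
  then obtain w where w[measurable]: "w \<in> borel_measurable borel" and w0: "\<And>x. 0 \<le> w x"
    and \<Omega>w: "AE x in sphere_borel. norm (\<Omega> x) = w x"
    using ex_borel_norm_sphere by blast
  \<comment> \<open>Homogeneity with the factor \<open>1 / norm x\<close>.\<close>
  have \<Omega>_hom: "norm (\<Omega> (sgn x)) = norm (\<Omega> x)" if "x \<noteq> 0" for x
    using hom that unfolding homogeneous_degree_zero_def sgn_div_norm by simp
  have \<Omega>_sgn: "AE x in lborel. norm (\<Omega> x) = w (sgn x)"
    using AE_lborel_sgn[OF \<Omega>w] AE_lborel_singleton[of "0::'a"]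
    by eventually_elim (simp add: \<Omega>_hom)
  have "finite_measure (sphere_lebesgue :: 'a measure)"
    using sets.top[of "sphere_borel :: 'a measure"]
    by (intro finite_measureI)
      (simp add: sphere_lebesgue_def space_sphere_borel emeasure_sphere_borel_UNIV)
  then have "(\<integral>\<^sup>+ x. ennreal (norm (\<Omega> x) powr q) \<partial>sphere_lebesgue) < \<infinity>"
    using \<Omega> s qp by (intro L_space_finite_measure_nn_integral_powr) (auto simp: q_def)
  also have "(\<integral>\<^sup>+ x. ennreal (norm (\<Omega> x) powr q) \<partial>sphere_lebesgue) =
      (\<integral>\<^sup>+ x. ennreal (w x powr q) \<partial>sphere_borel)"
    unfolding sphere_lebesgue_def nn_integral_completion
    using \<Omega>w by (intro nn_integral_cong_AE) auto
  finally obtain K where K: "(\<integral>\<^sup>+ x. ennreal (w x powr q) \<partial>sphere_borel) = ennreal K" "0 \<le> K"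
    by (auto simp: less_top_ennreal)
  \<comment> \<open>The first term is the norm of \<Omega> on the sphere with exponent
    \<open>q\<close>; adding 1 keeps \<open>C\<close> positive even if that norm is 0.\<close>
  define C where "C = K powr (1 / q) + 1"
  have "C > 0" by (simp add: C_def add_nonneg_pos)
  moreover have "eL_norm \<infinity> lebesgue (fractional_maximal \<Omega> \<alpha> f)
      \<le> ennreal C * L_norm (ennreal p) lebesgue f"
    if f: "f \<in> L_space (ennreal p) lebesgue" for f
  proof -
    have "f \<in> borel_measurable lebesgue" and fin: "L_norm (ennreal p) lebesgue f < \<infinity>"
      using f by (auto simp: L_space_def)
    then have "(\<lambda>x. norm (f x)) \<in> borel_measurable lebesgue" by measurable
    from completion_ex_borel_measurable_real[OF this] obtain h0
      where h0: "h0 \<in> borel_measurable borel" "AE x in lborel. norm (f x) = h0 x"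
      by auto
    define h where "h x = \<bar>h0 x\<bar>" for x
    have h[measurable]: "h \<in> borel_measurable borel" and h_nonneg: "\<And>x. 0 \<le> h x"
      using h0(1) by (auto simp: h_def[abs_def])
    have fh: "AE x in lborel. norm (f x) = h x"
      using h0(2) by eventually_elim (metis abs_norm_cancel h_def)
    have eq: "(\<integral>\<^sup>+ x. ennreal (norm (f x) powr p) \<partial>lebesgue) = (\<integral>\<^sup>+ x. ennreal (h x powr p) \<partial>lborel)"
      unfolding nn_integral_completion using fh by (intro nn_integral_cong_AE) auto
    then have "(\<integral>\<^sup>+ x. ennreal (h x powr p) \<partial>lborel) < \<infinity>"
      using fin qp(2) by (subst (asm) L_norm_finite_iff) auto
    then obtain H where H: "(\<integral>\<^sup>+ x. ennreal (h x powr p) \<partial>lborel) = ennreal H" "0 \<le> H"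
      by (auto simp: less_top_ennreal)
    have norm_f: "L_norm (ennreal p) lebesgue f = ennreal (H powr (1 / p))"
      using qp(2) H(2) by (simp add: L_norm_ennreal eq H(1) enn_powr_def)
    let ?c = "\<lambda>r. ennreal (1 / measure lborel (ball (0::'a) r) powr (1 - \<alpha> / n))"
    have M: "fractional_maximal \<Omega> \<alpha> f = (\<lambda>x. SUP r\<in>{0<..}. ?c r *
        (\<integral>\<^sup>+ y \<in> {y. norm (x - y) < r}. ennreal (w (sgn (x - y)) * h y) \<partial>lborel))"
      unfolding n_def by (intro ext fractional_maximal_cong_AE \<Omega>_sgn fh)
    \<comment> \<open>Larger balls have larger volume and \<open>1 - \<alpha> / n\<close> is
      positive; this is the monotonicity needed for restricting to rational radii.\<close>
    have "?c r' \<le> ?c r" if "0 < r" "r \<le> r'" for r r'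
    proof -
      have "measure lborel (ball (0::'a) r) \<le> measure lborel (ball (0::'a) r')"
        using that by (simp add: content_ball mult_left_mono power_mono)
      then have "measure lborel (ball (0::'a) r) powr (1 - \<alpha> / n) \<le> measure lborel (ball (0::'a) r') powr (1 - \<alpha> / n)"
        using \<alpha> by (intro powr_mono2) auto
      then show ?thesis
        using that by (intro ennreal_leI divide_left_mono) (auto simp: zero_less_measure_iff)
    qed
    then have "fractional_maximal \<Omega> \<alpha> f \<in> borel_measurable borel"
      unfolding M by (intro borel_measurable_SUP_radius) measurable
    then have meas: "fractional_maximal \<Omega> \<alpha> f \<in> borel_measurable lebesgue"
      by (simp add: measurable_completion)
    \<comment> \<open>The bound holds at every point and for every radius, so it passes to the
      essential supremum.\<close>
    have "fractional_maximal \<Omega> \<alpha> f x \<le> ennreal (C * H powr (1 / p))" for x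
      unfolding M
    proof (rule SUP_least)
      fix r :: real assume "r \<in> {0<..}"
      then have r: "r > 0" by simp
      define m where "m = measure lborel (ball (0::'a) r)"
      have m: "m > 0" using r by (simp add: m_def)
      have "?c r * (\<integral>\<^sup>+ y \<in> {y. norm (x - y) < r}. ennreal (w (sgn (x - y)) * h y) \<partial>lborel)
          \<le> ?c r * ennreal ((m * K) powr (1 / q) * H powr (1 / p))"
        unfolding m_def
        by (intro mult_left_mono nn_integral_ball_rough_kernel_le w h w0 h_nonneg qp K H r) auto
      also have "\<dots> = ennreal (1 / m powr (1 / q) * ((m * K) powr (1 / q) * H powr (1 / p)))"
        unfolding m_def[symmetric] qp(4)[symmetric] by (rule ennreal_mult'[symmetric]) simp
      \<comment> \<open>The power of the volume produced by Hoelder's inequality cancels the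
        normalization, which leaves a bound independent of \<open>r\<close>.\<close>
      also have "1 / m powr (1 / q) * ((m * K) powr (1 / q) * H powr (1 / p)) = K powr (1 / q) * H powr (1 / p)"
        using m K(2) by (simp add: powr_mult)
      also have "ennreal \<dots> \<le> ennreal (C * H powr (1 / p))"
        by (intro ennreal_leI mult_right_mono) (auto simp: C_def)
      finally show "?c r * (\<integral>\<^sup>+ y \<in> {y. norm (x - y) < r}. ennreal (w (sgn (x - y)) * h y) \<partial>lborel)
          \<le> ennreal (C * H powr (1 / p))" .
    qed
    then have "esssup lebesgue (fractional_maximal \<Omega> \<alpha> f) \<le> ennreal (C * H powr (1 / p))"
      using meas by (intro esssup_I) auto
    then show ?thesis
      using \<open>C > 0\<close> by (simp add: eL_norm_def norm_f ennreal_mult')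
  qed
  ultimately show ?thesis by (auto simp: p_def)
qed

theorem theorem2p8:
  fixes \<Omega> :: "real ^ 'n \<Rightarrow> complex" and \<alpha> p :: real and s :: ennreal
  assumes "CARD('n) \<ge> 2"
    and "0 < \<alpha>" and "\<alpha> < real CARD('n)"
    and "p = real CARD('n) / \<alpha>"
    and "homogeneous_degree_zero \<Omega>"
    and "s \<ge> ennreal (real CARD('n) / (real CARD('n) - \<alpha>))"
    and "\<Omega> \<in> L_space s sphere_lebesgue"
  shows "\<exists>C::real. C > 0 \<and>
    (\<forall>f \<in> L_space (ennreal p) lebesgue.
      eL_norm \<infinity> lebesgue (fractional_maximal \<Omega> \<alpha> f)
        \<le> ennreal C * L_norm (ennreal p) lebesgue f)"
  \<comment> \<open>The dimension of \<open>real ^ 'n\<close> is \<open>CARD('n)\<close>.\<close>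
  using fractional_maximal_bounded[of \<alpha> \<Omega> s] assms by simp

end
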